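(* Let $n\ge2$. There is a bijection between (1) unlabeled non-oriented cyclic quivers with $n$ vertices, and (2) skeletal quiddity sequences $q=(a_1,\dots,a_p)$ with $1\le p<n$ and $n=p+\sum_{k=1}^p(a_k-2)$.
   Context: A non-oriented cyclic quiver is a quiver whose underlying graph is a cycle and whose arrows are not all oriented in the same cyclic direction. Friezes: given positive integers $(a_i)_{i\in\mathbb{Z}}$, define $a_{i,j}$ ($j\ge i-2$) by $a_{i,i-2}=0$, $a_{i,i-1}=1$, $a_{i,i}=a_i$ and $a_{i,j}a_{i+1,j+1}-a_{i,j+1}a_{i+1,j}=1$; this is an infinite frieze if all $a_{i,j}$ with $j\ge i$ are positive integers, periodic with quiddity sequence $(a_1,\dots,a_p)$ if $a_{i+p}=a_i$ for all $i$; quiddity sequences are considered up to cyclic rotation. A quiddity sequence (of an infinite periodic frieze) is skeletal if none of its entries equals $1$ and it is not $(2,2,\dots,2)$.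
   Formalization: Unlabeled quivers are taken as drawn on an oriented circle, up to relabelling and rotation but not reflection; up to abstract isomorphism the claim fails for n=3 (one acyclic triangle, but two skeletal quiddity sequences (4) and (2,3)). *)

theory Defs
  imports "Graph_Theory.Digraph_Isomorphism"
begin

section \<open>Cyclic quivers\<close>

text \<open>
  A quiver is a \<^typ>\<open>('v, 'e) pre_digraph\<close> (loops and parallel arrows allowed).
  In a traversal of its underlying cycle, the edge \<open>es ! i\<close> joins \<open>vs ! i\<close> to the
  cyclically next vertex. Edges are listed separately because for two vertices they
  are not determined by their ends.
\<close>

definition cycle_traversal :: "('v, 'e) pre_digraph \<Rightarrow> 'v list \<Rightarrow> 'e list \<Rightarrow> bool" where
  "cycle_traversal G vs es \<longleftrightarrow>
     distinct vs \<and> set vs = verts G \<and>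
     distinct es \<and> set es = arcs G \<and>
     length es = length vs \<and> vs \<noteq> [] \<and>
     (\<forall>i < length vs. {tail G (es ! i), head G (es ! i)}
                      = {vs ! i, vs ! (Suc i mod length vs)})"

definition forward_arcs :: "('v, 'e) pre_digraph \<Rightarrow> 'v list \<Rightarrow> 'e list \<Rightarrow> 'e set" where
  "forward_arcs G vs es =
     {es ! i | i. i < length vs \<and>
        tail G (es ! i) = vs ! i \<and> head G (es ! i) = vs ! (Suc i mod length vs)}"

text \<open>
  A cyclic quiver is drawn on a circle, so that each of its arrows is either clockwise or
  counterclockwise. It is represented as \<open>(G, K)\<close>, where \<open>K\<close> is the set of clockwise
  arrows: those followed in their own direction by a clockwise traversal of the cycle.
\<close>

definition cyclic_quiver :: "('v, 'e) pre_digraph \<times> 'e set \<Rightarrow> bool" where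
  "cyclic_quiver Q \<longleftrightarrow>
     (\<exists>vs es. cycle_traversal (fst Q) vs es \<and> snd Q = forward_arcs (fst Q) vs es)"

definition non_oriented_cyclic_quivers ::
    "nat \<Rightarrow> (('v, 'e) pre_digraph \<times> 'e set) set" where
  "non_oriented_cyclic_quivers n =
     {(G, K). cyclic_quiver (G, K) \<and> card (verts G) = n \<and> K \<noteq> {} \<and> K \<noteq> arcs G}"

text \<open>
  Forgetting the labels means passing to isomorphism classes of drawn quivers, that is,
  relabelling and rotating, but not reflecting the circle. With reflections there would be
  a single class for \<open>n = 3\<close>, while \<open>(4)\<close> and \<open>(2, 3)\<close> are two different
  skeletal quiddity sequences with \<open>n = 3\<close>.
\<close>

definition same_unlabeled_quiver ::
    "nat \<Rightarrow> ((('v, 'e) pre_digraph \<times> 'e set) \<times> (('v, 'e) pre_digraph \<times> 'e set)) set" where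
  "same_unlabeled_quiver n =
     {((G, K), (H, L)).
        (G, K) \<in> non_oriented_cyclic_quivers n \<and> (H, L) \<in> non_oriented_cyclic_quivers n \<and>
        (\<exists>h. pre_digraph.digraph_isomorphism G h \<and> H = app_iso h G \<and> L = iso_arcs h ` K)}"

definition unlabeled_non_oriented_cyclic_quivers ::
    "nat \<Rightarrow> (('v, 'e) pre_digraph \<times> 'e set) set set" where
  "unlabeled_non_oriented_cyclic_quivers n =
     non_oriented_cyclic_quivers n // same_unlabeled_quiver n"


section \<open>Infinite friezes and skeletal quiddity sequences\<close>

text \<open>
  \<open>m i j\<close> is the entry \<open>a\<^sub>i\<^sub>,\<^sub>j\<close>; it is constrained only for \<open>j \<ge> i - 2\<close>. As long as the
  entries with \<open>j \<ge> i\<close> are nonzero, the relations determine the array from \<open>a\<close>.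
\<close>

definition frieze_array :: "(int \<Rightarrow> int) \<Rightarrow> (int \<Rightarrow> int \<Rightarrow> int) \<Rightarrow> bool" where
  "frieze_array a m \<longleftrightarrow>
     (\<forall>i. m i (i - 2) = 0 \<and> m i (i - 1) = 1 \<and> m i i = a i) \<and>
     (\<forall>i j. j \<ge> i - 1 \<longrightarrow> m i j * m (i + 1) (j + 1) - m i (j + 1) * m (i + 1) j = 1)"

definition infinite_frieze :: "(int \<Rightarrow> int) \<Rightarrow> bool" where
  "infinite_frieze a \<longleftrightarrow>
     (\<forall>i. a i > 0) \<and> (\<exists>m. frieze_array a m \<and> (\<forall>i j. j \<ge> i \<longrightarrow> m i j > 0))"

text \<open>
  The list \<open>q\<close> stands for \<open>(a\<^sub>1, \<dots>, a\<^sub>p)\<close>; the period \<open>p\<close> need not be minimal.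
\<close>

definition quiddity_sequence :: "int list \<Rightarrow> bool" where
  "quiddity_sequence q \<longleftrightarrow>
     q \<noteq> [] \<and> infinite_frieze (\<lambda>i. q ! nat ((i - 1) mod int (length q)))"

definition skeletal :: "int list \<Rightarrow> bool" where
  "skeletal q \<longleftrightarrow>
     quiddity_sequence q \<and> 1 \<notin> set q \<and> q \<noteq> replicate (length q) 2"

definition skeletal_sequences :: "nat \<Rightarrow> int list set" where
  "skeletal_sequences n =
     {q. skeletal q \<and> 1 \<le> length q \<and> length q < n \<and>
         int n = int (length q) + (\<Sum>a\<leftarrow>q. a - 2)}"

definition same_up_to_rotation :: "nat \<Rightarrow> (int list \<times> int list) set" where
  "same_up_to_rotation n =
     {(q, q'). q \<in> skeletal_sequences n \<and> q' \<in> skeletal_sequences n \<and>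
               (\<exists>m. q' = rotate m q)}"

definition skeletal_sequences_up_to_rotation :: "nat \<Rightarrow> int list set set" where
  "skeletal_sequences_up_to_rotation n = skeletal_sequences n // same_up_to_rotation n"

end

theory Submission
  imports Defs
begin

text \<open>
  Reading the arrows of a drawn cyclic quiver in clockwise order and recording which of them
  are clockwise gives a binary word, unique up to rotation, and this word determines the drawn
  quiver up to isomorphism. The quiver is non-oriented iff both letters occur. Such a word can be
  rotated so that it starts with \<open>True\<close>; it then splits uniquely into blocks consisting of
  \<open>True\<close> followed by \<open>a - 2\<close> letters \<open>False\<close> with \<open>a \<ge> 2\<close>, and the sequence of these numbers
  \<open>a\<close> is a skeletal quiddity sequence. Conversely every sequence of integers \<open>\<ge> 2\<close> is the
  quiddity sequence of an infinite frieze, because its continuants increase.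
\<close>

section \<open>Bijections between quotients\<close>

text \<open>A choice \<open>f\<close> of related elements preserves and reflects the two relations,
  so it induces an injective map of classes; right totality makes it onto. As \<open>r\<close> is
  the pullback of \<open>s\<close> along \<open>f\<close>, it is an equivalence
  automatically.\<close>

lemma ex_bij_betw_quotients:
  assumes s: "equiv B s" and r: "r \<subseteq> A \<times> A"
    and left_total: "\<And>a. a \<in> A \<Longrightarrow> \<exists>b\<in>B. C a b"
    and right_total: "\<And>b. b \<in> B \<Longrightarrow> \<exists>a\<in>A. C a b"
    and iff: "\<And>a a' b b'. \<lbrakk>a \<in> A; a' \<in> A; b \<in> B; b' \<in> B; C a b; C a' b'\<rbrakk>
      \<Longrightarrow> (a, a') \<in> r \<longleftrightarrow> (b, b') \<in> s"
  shows "\<exists>\<Phi>. bij_betw \<Phi> (A // r) (B // s)"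
proof -
  obtain f where f: "\<And>a. a \<in> A \<Longrightarrow> f a \<in> B \<and> C a (f a)"
    using left_total by metis
  have r_iff: "(a, a') \<in> r \<longleftrightarrow> a \<in> A \<and> a' \<in> A \<and> (f a, f a') \<in> s" for a a'
  proof (cases "a \<in> A \<and> a' \<in> A")
    case True
    then show ?thesis
      using iff[of a a' "f a" "f a'"] f by simp
  next
    case False
    then show ?thesis
      using r by auto
  qed
  have s_class: "s `` {b} = s `` {b'} \<longleftrightarrow> (b, b') \<in> s" if "b \<in> B" "b' \<in> B" for b b'
    using eq_equiv_class_iff[OF s that] .
  have r: "equiv A r"
  proof (rule equivI)
    show "refl_on A r"
      using f r_iff equiv_class_self[OF s] by (auto intro!: refl_onI)
    show "sym r"
      using r_iff s by (meson equivE symD symI)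
    show "trans r"
      using r_iff s by (meson equivE transD transI)
  qed (rule r)
  \<comment> \<open>Saturating under \<open>s\<close> turns the image of a class, which
    \<open>f\<close> may scatter inside one class of \<open>B\<close>, into that whole
    class.\<close>
  define \<Phi> where "\<Phi> X = s `` (f ` X)" for X
  have \<Phi>: "\<Phi> (r `` {a}) = s `` {f a}" if "a \<in> A" for a
  proof -
    have "s `` {f a'} = s `` {f a}" if "a' \<in> r `` {a}" for a'
      using that r_iff equiv_class_eq[OF s] by fastforce
    moreover have "a \<in> r `` {a}"
      using equiv_class_self[OF r that] .
    ultimately show ?thesis
      unfolding \<Phi>_def by blast
  qed
  have "bij_betw \<Phi> (A // r) (B // s)"
  proof (rule bij_betw_imageI)
    show "inj_on \<Phi> (A // r)"
    proof (rule inj_onI)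
      fix X Y assume "X \<in> A // r" "Y \<in> A // r" and eq: "\<Phi> X = \<Phi> Y"
      then obtain a a' where a: "a \<in> A" "X = r `` {a}" and a': "a' \<in> A" "Y = r `` {a'}"
        by (auto elim!: quotientE)
      have "(f a, f a') \<in> s"
        using eq a a' by (simp add: \<Phi> f s_class)
      then show "X = Y"
        using a a' r_iff equiv_class_eq[OF r] by simp
    qed
    show "\<Phi> ` (A // r) = B // s"
    proof (intro subset_antisym subsetI)
      fix Y assume "Y \<in> \<Phi> ` (A // r)"
      then obtain a where "a \<in> A" "Y = \<Phi> (r `` {a})"
        by (auto elim!: quotientE)
      then show "Y \<in> B // s"
        using f by (simp add: \<Phi> quotientI)
    next
      fix Y assume "Y \<in> B // s"
      then obtain b where b: "b \<in> B" "Y = s `` {b}"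
        by (auto elim!: quotientE)
      obtain a where a: "a \<in> A" "C a b"
        using right_total b(1) by blast
      have "(a, a) \<in> r"
        using equiv_class_self[OF r a(1)] by simp
      then have "(f a, b) \<in> s"
        using iff[of a a "f a" b] a b f by simp
      then have "Y = \<Phi> (r `` {a})"
        using a b f by (simp add: \<Phi> s_class[symmetric])
      then show "Y \<in> \<Phi> ` (A // r)"
        using a(1) quotientI by fast
    qed
  qed
  then show ?thesis by blast
qed


section \<open>Clockwise orders of the arrows\<close>

text \<open>The ends of an arrow are ordered as a clockwise traversal meets them, so an arrow
  outside \<open>K\<close> is passed against its direction.\<close>

definition source :: "('v, 'e) pre_digraph \<Rightarrow> 'e set \<Rightarrow> 'e \<Rightarrow> 'v" where
  "source G K e = (if e \<in> K then tail G e else head G e)"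

definition target :: "('v, 'e) pre_digraph \<Rightarrow> 'e set \<Rightarrow> 'e \<Rightarrow> 'v" where
  "target G K e = (if e \<in> K then head G e else tail G e)"

text \<open>The traversal is encoded by its arrows and \<open>K\<close> alone: the vertex list is
  recovered as the list of sources, and \<open>rotate1\<close> says that each arrow ends where the
  cyclically next one starts.\<close>

definition clockwise_order :: "('v, 'e) pre_digraph \<Rightarrow> 'e set \<Rightarrow> 'e list \<Rightarrow> bool" where
  "clockwise_order G K es \<longleftrightarrow>
     distinct es \<and> set es = arcs G \<and> K \<subseteq> arcs G \<and>
     distinct (map (source G K) es) \<and> set (map (source G K) es) = verts G \<and>
     map (target G K) es = rotate1 (map (source G K) es)"

lemma clockwise_order_length:
  "clockwise_order G K es \<Longrightarrow> length es = card (verts G)"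
  unfolding clockwise_order_def by (metis distinct_card length_map)

lemma clockwise_order_traversal:
  assumes trav: "cycle_traversal G vs es"
  shows "clockwise_order G (forward_arcs G vs es) es"
proof -
  let ?K = "forward_arcs G vs es"
  have len: "length es = length vs" and ends: "\<And>i. i < length vs \<Longrightarrow>
      {tail G (es ! i), head G (es ! i)} = {vs ! i, vs ! (Suc i mod length vs)}"
    and dist: "distinct es"
    using trav by (auto simp: cycle_traversal_def)
  have "es ! i \<in> ?K \<longleftrightarrow> tail G (es ! i) = vs ! i \<and> head G (es ! i) = vs ! (Suc i mod length vs)"
    if "i < length vs" for i
    using that dist len by (auto simp: forward_arcs_def nth_eq_iff_index_eq)
  \<comment> \<open>The ends agree as sets with a vertex and its successor, so an arrow that is not
    forward runs from the successor back to the vertex.\<close>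
  then have *: "source G ?K (es ! i) = vs ! i \<and> target G ?K (es ! i) = vs ! (Suc i mod length vs)"
    if "i < length vs" for i
    using that ends[OF that] by (auto simp: source_def target_def doubleton_eq_iff)
  have "map (source G ?K) es = vs"
    using * len by (auto intro: nth_equalityI)
  moreover have "map (target G ?K) es = rotate1 vs"
    using * len by (auto intro!: nth_equalityI simp: nth_rotate1)
  moreover have "?K \<subseteq> arcs G"
    using trav by (auto simp: forward_arcs_def cycle_traversal_def)
  ultimately show ?thesis
    using trav by (auto simp: clockwise_order_def cycle_traversal_def)
qed

text \<open>
  With a single vertex a loop is always forward, so the converse fails for \<open>K = {}\<close>.
\<close>
lemma cyclic_quiver_clockwise_order:
  assumes order: "clockwise_order G K es" and len: "2 \<le> length es"
  shows "cyclic_quiver (G, K)"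
proof -
  let ?vs = "map (source G K) es"
  have target: "target G K (es ! i) = ?vs ! (Suc i mod length ?vs)" if "i < length es" for i
  proof -
    have "target G K (es ! i) = rotate1 ?vs ! i"
      using order that by (metis clockwise_order_def nth_map)
    then show ?thesis
      using that by (simp add: nth_rotate1)
  qed
  have distinct: "distinct ?vs" and set: "set es = arcs G" "K \<subseteq> arcs G"
    using order by (auto simp: clockwise_order_def)
  \<comment> \<open>This is where two arrows are required: consecutive vertices differ, so an arrow
    outside \<open>K\<close> cannot also count as forward.\<close>
  have neq: "?vs ! i \<noteq> ?vs ! (Suc i mod length ?vs)" if "i < length es" for i
  proof -
    have "i \<noteq> Suc i mod length ?vs"
      using that len by (cases "Suc i = length es") auto
    then show ?thesis
      using that len distinct by (metis length_map mod_less_divisor nth_eq_iff_index_eq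
          order_le_less_trans zero_le)
  qed
  have "cycle_traversal G ?vs es"
    unfolding cycle_traversal_def
  proof (intro conjI allI impI)
    fix i assume "i < length ?vs"
    then show "{tail G (es ! i), head G (es ! i)} = {?vs ! i, ?vs ! (Suc i mod length ?vs)}"
      using target[of i] by (auto simp: source_def target_def split: if_splits)
  qed (use order len in \<open>auto simp: clockwise_order_def\<close>)
  moreover have "K = forward_arcs G ?vs es"
  proof -
    have fwd: "es ! i \<in> K \<longleftrightarrow>
        tail G (es ! i) = ?vs ! i \<and> head G (es ! i) = ?vs ! (Suc i mod length ?vs)"
      if "i < length es" for i
      using target[OF that] neq[OF that] that
      by (auto simp: source_def target_def simp del: length_map split: if_splits)
    have "K = {es ! i | i. i < length es \<and> es ! i \<in> K}"
    proof -
      have "\<exists>i. e = es ! i \<and> i < length es" if "e \<in> K" for e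
        using set that by (metis in_set_conv_nth subsetD)
      then show ?thesis by blast
    qed
    then show ?thesis
      using fwd unfolding forward_arcs_def by (smt (verit) Collect_cong length_map)
  qed
  ultimately show ?thesis
    by (auto simp: cyclic_quiver_def)
qed

section \<open>Rotation and uniqueness of clockwise orders\<close>

lemma clockwise_order_rotate:
  assumes "clockwise_order G K es"
  shows "clockwise_order G K (rotate m es)"
  using assms unfolding clockwise_order_def
  by (simp only: rotate_map[symmetric] set_rotate distinct_rotate rotate1_rotate_swap simp_thms)

text \<open>Sources are injective on arrows, so the target of an arrow determines the arrow that
  follows it. Both orders run through the same successor cycle and agree once their starting points
  are aligned.\<close>

lemma clockwise_order_unique:
  assumes es: "clockwise_order G K es" and fs: "clockwise_order G K fs"
  shows "\<exists>m. fs = rotate m es"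
proof (cases "es = []")
  case True
  then show ?thesis
    using es fs by (auto simp: clockwise_order_def)
next
  case False
  let ?n = "length es"
  have len: "length fs = ?n"
    using clockwise_order_length[OF es] clockwise_order_length[OF fs] by simp
  have pos: "0 < ?n"
    using False by simp
  have next_arc: "target G K (gs ! i) = source G K (gs ! (Suc i mod ?n))"
    if "clockwise_order G K gs" "length gs = ?n" "i < ?n" for gs i
  proof -
    have "target G K (gs ! i) = rotate1 (map (source G K) gs) ! i"
      using that by (metis clockwise_order_def nth_map)
    also have "\<dots> = source G K (gs ! (Suc i mod ?n))"
      using that pos by (simp add: nth_rotate1)
    finally show ?thesis .
  qed
  have inj: "inj_on (source G K) (arcs G)"
    using es by (auto simp: clockwise_order_def distinct_map)
  have arcs: "es ! i \<in> arcs G" "fs ! i \<in> arcs G" if "i < ?n" for i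
    using that es fs len by (auto simp: clockwise_order_def)
  have "fs ! 0 \<in> set es"
    using arcs(2)[OF pos] es by (simp add: clockwise_order_def)
  then obtain m where m: "m < ?n" "fs ! 0 = es ! m"
    by (auto simp: in_set_conv_nth)
  have "fs ! i = es ! ((m + i) mod ?n)" if "i < ?n" for i
    using that
  proof (induction i)
    case (Suc i)
    let ?j = "(m + i) mod ?n"
    have j: "?j < ?n" "Suc ?j mod ?n < ?n"
      using pos by auto
    have "source G K (fs ! Suc i) = target G K (fs ! i)"
      using next_arc[OF fs len, of i] Suc.prems by simp
    also have "\<dots> = source G K (es ! (Suc ?j mod ?n))"
      using Suc next_arc[OF es refl j(1)] by simp
    finally have "fs ! Suc i = es ! (Suc ?j mod ?n)"
      using inj arcs(1)[OF j(2)] arcs(2)[OF Suc.prems] by (auto dest: inj_onD)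
    then show ?case
      by (simp add: mod_Suc_eq)
  qed (use m in simp)
  then have "fs = rotate m es"
    using len by (auto intro!: nth_equalityI simp: nth_rotate add.commute)
  then show ?thesis ..
qed

text \<open>The arrow map is injective, so it transports membership in \<open>K\<close> faithfully;
  therefore the isomorphism commutes with \<open>source\<close> and \<open>target\<close>, and the
  binary word is an invariant.\<close>

lemma clockwise_order_app_iso:
  assumes order: "clockwise_order G K es" and iso: "pre_digraph.digraph_isomorphism G h"
  shows "clockwise_order (app_iso h G) (iso_arcs h ` K) (map (iso_arcs h) es)"
    and "map (\<lambda>e. e \<in> iso_arcs h ` K) (map (iso_arcs h) es) = map (\<lambda>e. e \<in> K) es"
proof -
  let ?H = "app_iso h G" and ?L = "iso_arcs h ` K"
  have set: "set es = arcs G" "K \<subseteq> arcs G" "distinct es"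
    and verts: "distinct (map (source G K) es)" "set (map (source G K) es) = verts G"
    and tgt: "map (target G K) es = rotate1 (map (source G K) es)"
    using order by (auto simp: clockwise_order_def)
  have inj_arcs: "inj_on (iso_arcs h) (arcs G)" and inj_verts: "inj_on (iso_verts h) (verts G)"
    and ends: "\<And>e. e \<in> arcs G \<Longrightarrow> iso_verts h (tail G e) = iso_tail h (iso_arcs h e) \<and>
      iso_verts h (head G e) = iso_head h (iso_arcs h e)"
    using iso by (auto simp: pre_digraph.digraph_isomorphism_def)
  have mem: "iso_arcs h e \<in> ?L \<longleftrightarrow> e \<in> K" if "e \<in> arcs G" for e
    using inj_arcs set that by (auto dest: inj_onD)
  then show "map (\<lambda>e. e \<in> ?L) (map (iso_arcs h) es) = map (\<lambda>e. e \<in> K) es"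
    using set by auto
  have src: "map (source ?H ?L) (map (iso_arcs h) es) = map (iso_verts h) (map (source G K) es)"
    using set mem ends by (auto simp: source_def)
  have "map (target ?H ?L) (map (iso_arcs h) es) = map (iso_verts h) (map (target G K) es)"
    using set mem ends by (auto simp: target_def)
  also have "\<dots> = rotate1 (map (source ?H ?L) (map (iso_arcs h) es))"
    unfolding tgt src by (simp add: rotate1_map)
  finally show "clockwise_order ?H ?L (map (iso_arcs h) es)"
    unfolding clockwise_order_def src
    using set verts inj_arcs inj_verts by (auto simp: distinct_map comp_inj_on simp flip: image_image)
qed

section \<open>Isomorphisms from equal words\<close>

lemma ex_map_eq:
  assumes "distinct xs" "length xs = length ys"
  shows "\<exists>f. map f xs = ys"
proof
  show "map (the \<circ> map_of (zip xs ys)) xs = ys"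
    using assms by (auto intro!: nth_equalityI simp: map_of_zip_nth)
qed

text \<open>Arrows and sources are matched position by position. Targets then match as well, and
  equal letters ensure that tails go to tails and heads to heads.\<close>

lemma isomorphic_if_same_word:
  assumes es: "clockwise_order G K es" and fs: "clockwise_order H L fs"
    and word: "map (\<lambda>e. e \<in> K) es = map (\<lambda>e. e \<in> L) fs"
  shows "\<exists>h. pre_digraph.digraph_isomorphism G h \<and> H = app_iso h G \<and> L = iso_arcs h ` K"
proof -
  let ?src = "source G K" and ?tgt = "target G K" and ?src' = "source H L" and ?tgt' = "target H L"
  have len: "length es = length fs"
    using word by (metis length_map)
  have es': "set es = arcs G" "K \<subseteq> arcs G" "distinct es"
    "distinct (map ?src es)" "set (map ?src es) = verts G" "map ?tgt es = rotate1 (map ?src es)"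
    using es by (auto simp: clockwise_order_def)
  have fs': "set fs = arcs H" "L \<subseteq> arcs H" "distinct fs"
    "distinct (map ?src' fs)" "set (map ?src' fs) = verts H" "map ?tgt' fs = rotate1 (map ?src' fs)"
    using fs by (auto simp: clockwise_order_def)
  obtain \<rho> where \<rho>: "map \<rho> es = fs"
    using ex_map_eq[OF es'(3) len] by blast
  obtain \<phi> where \<phi>: "map \<phi> (map ?src es) = map ?src' fs"
    using ex_map_eq[OF es'(4), of "map ?src' fs"] len by auto
  \<comment> \<open>Both target lists are the source lists rotated by one place, so matching the
    sources is enough.\<close>
  have "map \<phi> (map ?tgt es) = map ?tgt' fs"
    by (simp only: es'(6) fs'(6) rotate1_map[symmetric] \<phi>)
  then have tgt: "\<phi> (?tgt e) = ?tgt' (\<rho> e)" if "e \<in> arcs G" for e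
    using \<rho> es'(1) that by auto
  have src: "\<phi> (?src e) = ?src' (\<rho> e)" if "e \<in> arcs G" for e
    using \<phi> \<rho> es'(1) that by auto
  have mem: "e \<in> K \<longleftrightarrow> \<rho> e \<in> L" if "e \<in> arcs G" for e
    using word \<rho> es'(1) that by auto
  \<comment> \<open>\<open>app_iso\<close> takes its head and tail functions from \<open>h\<close>.
    Supplying those of \<open>H\<close> gives equality of records, even at values outside the
    arcs.\<close>
  define h where "h = \<lparr>iso_verts = \<phi>, iso_arcs = \<rho>, iso_head = head H, iso_tail = tail H\<rparr>"
  have verts_img: "\<phi> ` verts G = verts H"
    using \<phi> es'(5) fs'(5) by (metis list.set_map)
  have arcs_img: "\<rho> ` arcs G = arcs H"
    using \<rho> es'(1) fs'(1) by (metis list.set_map)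
  have "wf_digraph G"
  proof
    fix e assume "e \<in> arcs G"
    then have "?src e \<in> verts G" "?tgt e \<in> verts G"
      using es'(1,5) arg_cong[OF es'(6), of set] by auto
    then show "tail G e \<in> verts G" "head G e \<in> verts G"
      by (auto simp: source_def target_def split: if_splits)
  qed
  moreover have "inj_on \<rho> (arcs G)"
    using \<rho> fs'(3) es'(1) by (metis distinct_map)
  moreover have "inj_on \<phi> (verts G)"
    using \<phi> fs'(4) es'(5) by (metis distinct_map)
  moreover have "\<phi> (tail G e) = tail H (\<rho> e) \<and> \<phi> (head G e) = head H (\<rho> e)" if "e \<in> arcs G" for e
    using src[OF that] tgt[OF that] mem[OF that]
    by (auto simp: source_def target_def split: if_splits)
  ultimately have "pre_digraph.digraph_isomorphism G h"
    by (simp add: pre_digraph.digraph_isomorphism_def h_def)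
  moreover have "H = app_iso h G"
    by (simp add: app_iso_def h_def verts_img arcs_img)
  moreover have "L = iso_arcs h ` K"
  proof -
    have "L = \<rho> ` K"
    proof (intro subset_antisym subsetI)
      fix f assume "f \<in> L"
      then obtain e where "f = \<rho> e" "e \<in> arcs G"
        using arcs_img fs'(2) by blast
      then show "f \<in> \<rho> ` K"
        using mem \<open>f \<in> L\<close> by simp
    next
      fix f assume "f \<in> \<rho> ` K"
      then show "f \<in> L"
        using mem es'(2) by auto
    qed
    then show ?thesis
      by (simp add: h_def)
  qed
  ultimately show ?thesis
    by blast
qed

lemma ex_clockwise_order:
  fixes w :: "bool list"
  shows "\<exists>(G :: (nat, nat) pre_digraph) K es. clockwise_order G K es \<and> map (\<lambda>e. e \<in> K) es = w"
proof -
  let ?n = "length w"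
  define K where "K = {i. i < ?n \<and> w ! i}"
  \<comment> \<open>The circle has the positions of \<open>w\<close> as vertices and as arrows; the
    letter at \<open>i\<close> directs the arrow between \<open>i\<close> and its cyclic
    successor.\<close>
  define G where "G = \<lparr>verts = {..<?n}, arcs = {..<?n},
    tail = (\<lambda>i. if i \<in> K then i else Suc i mod ?n),
    head = (\<lambda>i. if i \<in> K then Suc i mod ?n else i)\<rparr>"
  have src: "map (source G K) [0..<?n] = [0..<?n]"
    by (auto simp: source_def G_def map_idI)
  have "map (target G K) [0..<?n] = map (\<lambda>i. Suc i mod ?n) [0..<?n]"
    by (auto simp: target_def G_def)
  also have "\<dots> = rotate1 [0..<?n]"
    by (rule nth_equalityI) (auto simp: nth_rotate1 mod_less_divisor[OF order_le_less_trans])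
  finally have "clockwise_order G K [0..<?n]"
    unfolding clockwise_order_def src by (auto simp: G_def K_def)
  moreover have "map (\<lambda>e. e \<in> K) [0..<?n] = w"
    by (auto intro!: nth_equalityI simp: K_def)
  ultimately show ?thesis by blast
qed


section \<open>Skeletal sequences\<close>

text \<open>This is the frieze entry with indices \<open>i\<close> and \<open>i + k - 2\<close>; the
  shift by 2 makes the boundary rows 0 and 1 the base cases. For positive \<open>k\<close> it is the
  tridiagonal determinant of order \<open>k - 1\<close> with ones beside the diagonal.\<close>

fun continuant :: "(int \<Rightarrow> int) \<Rightarrow> int \<Rightarrow> nat \<Rightarrow> int" where
  "continuant a i 0 = 0"
| "continuant a i (Suc 0) = 1"
| "continuant a i (Suc (Suc k)) = a (i + int k) * continuant a i (Suc k) - continuant a i k"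

text \<open>The left side is a determinant of consecutive values of two solutions of one recurrence,
  whose step has determinant 1. It is therefore constant in \<open>k\<close>.\<close>

lemma continuant_diamond:
  "continuant a i (Suc k) * continuant a (i + 1) (Suc k)
    - continuant a i (Suc (Suc k)) * continuant a (i + 1) k = 1"
proof (induction k)
  case (Suc k)
  have "i + 1 + int k = i + int (Suc k)"
    by simp
  then show ?case
    using Suc by (simp add: algebra_simps)
qed simp

text \<open>Coefficients at least 2 make the sequence convex: each increment is at least the
  previous one, and the first is 1.\<close>

lemma continuant_increasing:
  assumes "\<And>i. a i \<ge> 2"
  shows "0 \<le> continuant a i k \<and> continuant a i k < continuant a i (Suc k)"
proof (induction k)
  case (Suc k)
  have "2 * continuant a i (Suc k) \<le> a (i + int k) * continuant a i (Suc k)"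
    using Suc assms by (intro mult_right_mono) auto
  moreover have "continuant a i (Suc (Suc k)) = a (i + int k) * continuant a i (Suc k) - continuant a i k"
    by simp
  ultimately show ?case
    using Suc by linarith
qed simp

lemma infinite_frieze_ge_2:
  assumes a: "\<And>i. a i \<ge> 2"
  shows "infinite_frieze a"
proof -
  define m where "m i j = continuant a i (nat (j - i + 2))" for i j
  have "m i (i - 2) = 0 \<and> m i (i - 1) = 1 \<and> m i i = a i" for i
    by (simp add: m_def numeral_2_eq_2)
  moreover have "m i j * m (i + 1) (j + 1) - m i (j + 1) * m (i + 1) j = 1" if "j \<ge> i - 1" for i j
  proof -
    have "nat (j - i + 2) = Suc (nat (j - i + 1))" "nat (j + 1 - (i + 1) + 2) = Suc (nat (j - i + 1))"
      "nat (j + 1 - i + 2) = Suc (Suc (nat (j - i + 1)))" "nat (j - (i + 1) + 2) = nat (j - i + 1)"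
      using that by auto
    then show ?thesis
      unfolding m_def by (simp only: continuant_diamond)
  qed
  moreover have "m i j > 0" if "j \<ge> i" for i j
  proof -
    have "nat (j - i + 2) = Suc (nat (j - i + 1))"
      using that by auto
    then show ?thesis
      unfolding m_def using continuant_increasing[of a i "nat (j - i + 1)"] a
      by (metis order_le_less_trans)
  qed
  ultimately have "frieze_array a m \<and> (\<forall>i j. j \<ge> i \<longrightarrow> m i j > 0)"
    by (simp add: frieze_array_def)
  moreover have "a i > 0" for i
    using a[of i] by simp
  ultimately show ?thesis
    unfolding infinite_frieze_def by blast
qed

text \<open>Friezes leave the argument here. Positive entries different from 1 are at least 2, and
  conversely \<open>infinite_frieze_ge_2\<close> supplies the frieze.\<close>

lemma skeletal_iff:
  "skeletal q \<longleftrightarrow> (\<forall>a\<in>set q. a \<ge> 2) \<and> (\<exists>a\<in>set q. a \<noteq> 2)"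
proof
  assume q: "skeletal q"
  then have pos: "q \<noteq> []" "\<And>i. q ! nat ((i - 1) mod int (length q)) > 0"
    and not1: "1 \<notin> set q" and not2: "q \<noteq> replicate (length q) 2"
    by (auto simp: skeletal_def quiddity_sequence_def infinite_frieze_def)
  have "a > 0" if "a \<in> set q" for a
  proof -
    obtain k where k: "k < length q" "q ! k = a"
      using \<open>a \<in> set q\<close> by (auto simp: in_set_conv_nth)
    \<comment> \<open>Sequences are indexed from 1 and lists from 0, hence the index
      \<open>int k + 1\<close>.\<close>
    then show ?thesis
      using pos(2)[of "int k + 1"] by simp
  qed
  then have "\<forall>a\<in>set q. a \<ge> 2"
    using not1 by (smt (verit))
  moreover have "\<exists>a\<in>set q. a \<noteq> 2"
    using not2 by (metis replicate_eqI)
  ultimately show "(\<forall>a\<in>set q. a \<ge> 2) \<and> (\<exists>a\<in>set q. a \<noteq> 2)" ..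
next
  assume q: "(\<forall>a\<in>set q. a \<ge> 2) \<and> (\<exists>a\<in>set q. a \<noteq> 2)"
  then have "q \<noteq> []"
    by auto
  then have "nat ((i - 1) mod int (length q)) < length q" for i
    by (simp add: nat_less_iff)
  then have "quiddity_sequence q"
    unfolding quiddity_sequence_def using q \<open>q \<noteq> []\<close> by (intro conjI infinite_frieze_ge_2) auto
  moreover have "q \<noteq> replicate (length q) 2"
    using q by (metis in_set_replicate)
  ultimately show "skeletal q"
    using q by (auto simp: skeletal_def)
qed


section \<open>Words of skeletal sequences\<close>

text \<open>For \<open>a < 2\<close>, \<open>nat\<close> truncates and the block equals that of 2;
  this is why the length formula and injectivity assume entries at least 2.\<close>

definition block :: "int \<Rightarrow> bool list" where
  "block a = True # replicate (nat (a - 2)) False"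

definition word :: "int list \<Rightarrow> bool list" where
  "word q = concat (map block q)"

lemma word_simps [simp]:
  "word [] = []" "word (a # q) = block a @ word q" "word (q @ q') = word q @ word q'"
  by (simp_all add: word_def)

lemma word_eq_Nil_iff [simp]: "word q = [] \<longleftrightarrow> q = []"
  by (cases q) (auto simp: block_def)

lemma hd_word: "q \<noteq> [] \<Longrightarrow> hd (word q)"
  by (cases q) (auto simp: block_def)

lemma length_word:
  "\<forall>a\<in>set q. a \<ge> 2 \<Longrightarrow> int (length (word q)) = int (length q) + (\<Sum>a\<leftarrow>q. a - 2)"
  by (induction q) (auto simp: block_def)

lemma True_in_word_iff: "True \<in> set (word q) \<longleftrightarrow> q \<noteq> []"
  by (cases q) (auto simp: block_def)

lemma False_in_word_iff:
  "\<forall>a\<in>set q. a \<ge> 2 \<Longrightarrow> False \<in> set (word q) \<longleftrightarrow> (\<exists>a\<in>set q. a \<noteq> 2)"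
  by (induction q) (auto simp: block_def)

text \<open>After its first letter a block contains only \<open>False\<close>, so a cut before
  \<open>True\<close> cannot fall strictly inside it.\<close>

lemma block_split:
  assumes "block a @ x = u @ v" "v = [] \<or> hd v" "u \<noteq> []"
  obtains u' where "u = block a @ u'" "x = u' @ v"
proof -
  from assms(1) consider us where "u = block a @ us" "x = us @ v"
    | us where "block a = u @ us" "us \<noteq> []" "v = us @ x"
    by (metis append.right_neutral append_Nil append_eq_append_conv2)
  then show ?thesis
  proof cases
    case 2
    have "tl (block a) = tl u @ us"
      using 2 assms(3) by (simp add: tl_append2)
    then have "hd us \<in> set (replicate (nat (a - 2)) False)"
      using 2(2) by (auto simp: block_def)
    then show ?thesis
      using 2 assms(2) by auto
  qed (use that in blast)
qed

text \<open>A word can be cut before any letter \<open>True\<close>, because such a letter starts a block.\<close>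
lemma word_split:
  assumes "word q = u @ v" "v = [] \<or> hd v"
  shows "\<exists>q1 q2. q = q1 @ q2 \<and> word q1 = u \<and> word q2 = v"
  using assms
proof (induction q arbitrary: u)
  case (Cons a q)
  show ?case
  proof (cases "u = []")
    case True
    then have "a # q = [] @ a # q \<and> word [] = u \<and> word (a # q) = v"
      using Cons.prems by simp
    then show ?thesis by blast
  next
    case False
    with Cons.prems obtain u' where u': "u = block a @ u'" "word q = u' @ v"
      by (auto elim: block_split)
    then obtain q1 q2 where "q = q1 @ q2 \<and> word q1 = u' \<and> word q2 = v"
      using Cons by blast
    then have "a # q = (a # q1) @ q2 \<and> word (a # q1) = u \<and> word q2 = v"
      using u' by simp
    then show ?thesis by blast
  qed
qed simp

text \<open>By \<open>block_split\<close> in both directions the two first blocks are prefixes of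
  each other, hence equal; cancelling them leaves the induction.\<close>

lemma word_inj:
  assumes "word q = word q'" "\<forall>a\<in>set q. a \<ge> 2" "\<forall>a\<in>set q'. a \<ge> 2"
  shows "q = q'"
  using assms
proof (induction q arbitrary: q')
  case Nil
  then show ?case by (metis word_eq_Nil_iff)
next
  case (Cons a q)
  then obtain b p where q': "q' = b # p"
    by (metis list.exhaust word_eq_Nil_iff list.distinct(1))
  have eq: "block a @ word q = block b @ word p"
    using Cons.prems(1) q' by simp
  have hd: "word r = [] \<or> hd (word r)" for r
    using hd_word[of r] by auto
  obtain us where us: "block b = block a @ us" "word q = us @ word p"
    using block_split[OF eq hd] by (auto simp: block_def)
  obtain vs where "block a = block b @ vs"
    using block_split[OF eq[symmetric] hd] by (auto simp: block_def)
  with us(1) have "us = []" by simp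
  then have "word q = word p" and "block a = block b"
    using us by auto
  then have "nat (a - 2) = nat (b - 2)"
    by (metis block_def length_Cons length_replicate nat.inject)
  then have "a = b"
    using Cons.prems q' by auto
  moreover have "q = p"
    using Cons \<open>word q = word p\<close> q' by auto
  ultimately show ?case
    using q' by simp
qed

lemma ex_word:
  assumes "w = [] \<or> hd w"
  shows "\<exists>q. (\<forall>a\<in>set q. a \<ge> 2) \<and> word q = w"
  using assms
proof (induction w rule: length_induct)
  case (1 w)
  show ?case
  proof (cases w)
    case (Cons x xs)
    \<comment> \<open>The run \<open>?ys\<close> of \<open>False\<close> completes the first block,
      and \<open>?zs\<close> is empty or starts with \<open>True\<close> again.\<close>
    let ?ys = "takeWhile Not xs" and ?zs = "dropWhile Not xs"
    have "length ?zs < length w"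
      using Cons by (simp add: length_dropWhile_le le_imp_less_Suc)
    moreover have "?zs = [] \<or> hd ?zs"
      using hd_dropWhile[of Not xs] by auto
    ultimately obtain q where q: "\<forall>a\<in>set q. a \<ge> 2" "word q = ?zs"
      using 1 by blast
    have "?ys = replicate (length ?ys) False"
      by (rule replicate_eqI) (auto dest: set_takeWhileD)
    then have "block (int (length ?ys) + 2) = x # ?ys"
      using Cons 1 by (simp add: block_def)
    then have "word ((int (length ?ys) + 2) # q) = w"
      using q Cons by simp
    then show ?thesis
      using q(1) by (intro exI[of _ "(int (length ?ys) + 2) # q"]) auto
  qed (auto intro: exI[of _ "[]"])
qed

section \<open>Rotations of sequences and of their words\<close>

lemma rotate_obtains_append:
  obtains u v where "xs = u @ v" "rotate m xs = v @ u"
  by (metis append_take_drop_id rotate_drop_take)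

lemma word_rotate: "\<exists>k. word (rotate m q) = rotate k (word q)"
proof -
  obtain u v where "q = u @ v" "rotate m q = v @ u"
    by (rule rotate_obtains_append)
  then have "word (rotate m q) = rotate (length (word u)) (word q)"
    by (simp add: rotate_append)
  then show ?thesis ..
qed

lemma rotate_word:
  assumes rot: "word q' = rotate m (word q)"
    and ge: "\<forall>a\<in>set q. a \<ge> 2" "\<forall>a\<in>set q'. a \<ge> 2"
  shows "\<exists>k. q' = rotate k q"
proof -
  obtain u v where uv: "word q = u @ v" "word q' = v @ u"
    using rot rotate_obtains_append by metis
  \<comment> \<open>If \<open>v\<close> is nonempty, its head is the head of \<open>word q'\<close>,
    which is \<open>True\<close>. So the rotation cuts \<open>word q\<close> at a block
    boundary.\<close>
  have "v = [] \<or> hd v"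
    using hd_word[of q'] uv(2) by (metis append_is_Nil_conv hd_append2 word_eq_Nil_iff)
  then obtain q1 q2 where q: "q = q1 @ q2" "word q1 = u" "word q2 = v"
    using word_split[OF uv(1)] by blast
  then have "word q' = word (q2 @ q1)"
    using uv by simp
  then have "q' = rotate (length q1) q"
    using word_inj[of q' "q2 @ q1"] ge q(1) by (auto simp: rotate_append)
  then show ?thesis ..
qed

text \<open>The sum condition prescribes the length of the word. An entry other than 2 amounts to a
  letter \<open>False\<close>, and this also forces the sequence to be shorter than its
  word.\<close>

lemma skeletal_sequences_iff:
  "q \<in> skeletal_sequences n \<longleftrightarrow>
    (\<forall>a\<in>set q. a \<ge> 2) \<and> length (word q) = n \<and> True \<in> set (word q) \<and> False \<in> set (word q)"
proof (cases "\<forall>a\<in>set q. a \<ge> 2")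
  case True
  have "length q < length (word q)" if "\<exists>a\<in>set q. a \<noteq> 2"
    using True that
  proof (induction q)
    case (Cons a q)
    have "length q \<le> length (word q)"
      by (induction q) (auto simp: block_def)
    then show ?case
      using Cons by (cases "a = 2") (auto simp: block_def)
  qed simp
  then show ?thesis
    using True length_word[OF True] False_in_word_iff[OF True]
    by (auto simp: skeletal_sequences_def skeletal_iff True_in_word_iff Suc_le_eq)
qed (auto simp: skeletal_sequences_def skeletal_iff)

lemma equiv_same_up_to_rotation: "equiv (skeletal_sequences n) (same_up_to_rotation n)"
proof (rule equivI)
  show "same_up_to_rotation n \<subseteq> skeletal_sequences n \<times> skeletal_sequences n"
    by (auto simp: same_up_to_rotation_def)
  show "refl_on (skeletal_sequences n) (same_up_to_rotation n)"
    by (auto simp: same_up_to_rotation_def refl_on_def intro: exI[of _ 0])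
  show "sym (same_up_to_rotation n)"
  proof (rule symI)
    fix p q :: "int list" assume pq: "(p, q) \<in> same_up_to_rotation n"
    then obtain m where "q = rotate m p"
      by (auto simp: same_up_to_rotation_def)
    moreover obtain u v where "p = u @ v" "rotate m p = v @ u"
      by (rule rotate_obtains_append)
    ultimately have "p = rotate (length v) q"
      by (simp add: rotate_append)
    then show "(q, p) \<in> same_up_to_rotation n"
      using pq by (auto simp: same_up_to_rotation_def)
  qed
  show "trans (same_up_to_rotation n)"
    by (rule transI) (auto simp: same_up_to_rotation_def rotate_rotate)
qed


section \<open>The bijection\<close>

text \<open>A relation rather than a function, since the word depends on the arrow at which the
  reading starts.\<close>

definition quiver_word :: "('v, 'e) pre_digraph \<times> 'e set \<Rightarrow> bool list \<Rightarrow> bool" where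
  "quiver_word Q w \<longleftrightarrow>
     (\<exists>es. clockwise_order (fst Q) (snd Q) es \<and> map (\<lambda>e. e \<in> snd Q) es = w)"

lemma quiver_word_rotate: "quiver_word Q w \<Longrightarrow> quiver_word Q (rotate m w)"
  unfolding quiver_word_def by (metis clockwise_order_rotate rotate_map)

lemma quiver_word_unique:
  "quiver_word Q w \<Longrightarrow> quiver_word Q w' \<Longrightarrow> \<exists>m. w' = rotate m w"
  unfolding quiver_word_def by (metis clockwise_order_unique rotate_map)

lemma non_oriented_cyclic_quivers_iff:
  assumes "n \<ge> 2" "quiver_word Q w"
  shows "Q \<in> non_oriented_cyclic_quivers n \<longleftrightarrow>
    length w = n \<and> True \<in> set w \<and> False \<in> set w"
proof -
  obtain G K where Q: "Q = (G, K)"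
    by force
  obtain es where es: "clockwise_order G K es" "map (\<lambda>e. e \<in> K) es = w"
    using assms(2) by (auto simp: quiver_word_def Q)
  have sets: "set es = arcs G" "K \<subseteq> arcs G"
    using es(1) by (auto simp: clockwise_order_def)
  have "length w = card (verts G)"
    using es clockwise_order_length by (metis length_map)
  moreover have "True \<in> set w \<longleftrightarrow> K \<noteq> {}" "False \<in> set w \<longleftrightarrow> K \<noteq> arcs G"
    using es(2) sets by auto
  moreover have "cyclic_quiver (G, K)" if "length w = n"
    using cyclic_quiver_clockwise_order[OF es(1)] es(2) that assms(1) by auto
  ultimately show ?thesis
    by (auto simp: non_oriented_cyclic_quivers_def Q)
qed

lemma ex_quiver_word:
  assumes "Q \<in> non_oriented_cyclic_quivers n"
  shows "\<exists>w. quiver_word Q w"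
proof -
  obtain vs es where "cycle_traversal (fst Q) vs es" "snd Q = forward_arcs (fst Q) vs es"
    using assms unfolding non_oriented_cyclic_quivers_def cyclic_quiver_def by blast
  then show ?thesis
    unfolding quiver_word_def using clockwise_order_traversal by metis
qed

text \<open>Isomorphisms preserve the word and two words of one quiver are rotations of each other;
  conversely, after rotating, equal words yield an isomorphism.\<close>

lemma same_unlabeled_quiver_iff:
  assumes Q: "Q \<in> non_oriented_cyclic_quivers n" "quiver_word Q w"
    and R: "R \<in> non_oriented_cyclic_quivers n" "quiver_word R w'"
  shows "(Q, R) \<in> same_unlabeled_quiver n \<longleftrightarrow> (\<exists>m. w' = rotate m w)"
proof
  assume "(Q, R) \<in> same_unlabeled_quiver n"
  then obtain h where "pre_digraph.digraph_isomorphism (fst Q) h"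
    "R = (app_iso h (fst Q), iso_arcs h ` snd Q)"
    by (auto simp: same_unlabeled_quiver_def)
  then have "quiver_word R w"
    using Q(2) clockwise_order_app_iso unfolding quiver_word_def by (metis fst_conv snd_conv)
  then show "\<exists>m. w' = rotate m w"
    using R(2) quiver_word_unique by blast
next
  assume "\<exists>m. w' = rotate m w"
  then have "quiver_word Q w'"
    using Q(2) quiver_word_rotate by blast
  then obtain h where "pre_digraph.digraph_isomorphism (fst Q) h"
    "fst R = app_iso h (fst Q)" "snd R = iso_arcs h ` snd Q"
    using R(2) isomorphic_if_same_word unfolding quiver_word_def by metis
  then show "(Q, R) \<in> same_unlabeled_quiver n"
    using Q(1) R(1) by (cases Q, cases R) (auto simp: same_unlabeled_quiver_def)
qed

theorem theorem3p20:
  fixes n :: nat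
  assumes "n \<ge> 2"
  shows "\<exists>\<Phi> :: ((nat, nat) pre_digraph \<times> nat set) set \<Rightarrow> int list set.
           bij_betw \<Phi> (unlabeled_non_oriented_cyclic_quivers n)
                       (skeletal_sequences_up_to_rotation n)"
  unfolding unlabeled_non_oriented_cyclic_quivers_def skeletal_sequences_up_to_rotation_def
proof (rule ex_bij_betw_quotients[where C = "\<lambda>Q q. quiver_word Q (word q)"])
  show "equiv (skeletal_sequences n) (same_up_to_rotation n)"
    by (rule equiv_same_up_to_rotation)
  show "same_unlabeled_quiver n \<subseteq> non_oriented_cyclic_quivers n \<times> non_oriented_cyclic_quivers n"
    by (auto simp: same_unlabeled_quiver_def)
next
  fix Q :: "(nat, nat) pre_digraph \<times> nat set"
  assume Q: "Q \<in> non_oriented_cyclic_quivers n"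
  obtain w where w: "quiver_word Q w"
    using ex_quiver_word[OF Q] by blast
  then have "True \<in> set w"
    using Q non_oriented_cyclic_quivers_iff[OF assms] by blast
  \<comment> \<open>Only a word starting with \<open>True\<close> splits into blocks, so the reading
    is restarted at a clockwise arrow.\<close>
  then obtain u v where "w = u @ True # v"
    by (meson split_list)
  then have "rotate (length u) w = True # v @ u"
    by (simp add: rotate_append)
  then obtain q where q: "\<forall>a\<in>set q. a \<ge> 2" "word q = rotate (length u) w"
    using ex_word[of "True # v @ u"] by auto
  then have "quiver_word Q (word q)"
    using w quiver_word_rotate by metis
  then show "\<exists>q\<in>skeletal_sequences n. quiver_word Q (word q)"
    using q(1) Q non_oriented_cyclic_quivers_iff[OF assms] skeletal_sequences_iff by blast
next
  fix q assume q: "q \<in> skeletal_sequences n"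
  obtain Q :: "(nat, nat) pre_digraph \<times> nat set" where "quiver_word Q (word q)"
    using ex_clockwise_order[of "word q"] unfolding quiver_word_def by (metis fst_conv snd_conv)
  then show "\<exists>Q\<in>non_oriented_cyclic_quivers n.
      quiver_word (Q :: (nat, nat) pre_digraph \<times> nat set) (word q)"
    using q non_oriented_cyclic_quivers_iff[OF assms] skeletal_sequences_iff by blast
next
  fix Q R :: "(nat, nat) pre_digraph \<times> nat set" and q r
  assume "Q \<in> non_oriented_cyclic_quivers n" "R \<in> non_oriented_cyclic_quivers n"
    "quiver_word Q (word q)" "quiver_word R (word r)"
    and qr: "q \<in> skeletal_sequences n" "r \<in> skeletal_sequences n"
  then have "(Q, R) \<in> same_unlabeled_quiver n \<longleftrightarrow> (\<exists>m. word r = rotate m (word q))"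
    by (simp add: same_unlabeled_quiver_iff)
  \<comment> \<open>Both words start with \<open>True\<close>, so a rotation between them permutes
    whole blocks cyclically.\<close>
  also have "\<dots> \<longleftrightarrow> (\<exists>k. r = rotate k q)"
  proof
    have "\<forall>a\<in>set q. a \<ge> 2" "\<forall>a\<in>set r. a \<ge> 2"
      using qr by (simp_all add: skeletal_sequences_iff)
    then show "\<exists>k. r = rotate k q" if "\<exists>m. word r = rotate m (word q)"
      using that rotate_word by blast
    show "\<exists>m. word r = rotate m (word q)" if "\<exists>k. r = rotate k q"
      using that word_rotate by auto
  qed
  also have "\<dots> \<longleftrightarrow> (q, r) \<in> same_up_to_rotation n"
    using qr by (simp add: same_up_to_rotation_def)
  finally show "(Q, R) \<in> same_unlabeled_quiver n \<longleftrightarrow> (q, r) \<in> same_up_to_rotation n" .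
qed

end
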